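(* Consider a two-level quantum system undergoing a phase-covariant dynamics $$\dot\rho_A=\mathcal L_t\rho_A=-\tfrac{i}{\hbar}[\Omega_A(t)\sigma_+\sigma_-,\rho_A]+\gamma_1(t)\big[\sigma_+\rho_A\sigma_--\tfrac12\{\sigma_-\sigma_+,\rho_A\}\big]+\gamma_2(t)\big[\sigma_-\rho_A\sigma_+-\tfrac12\{\sigma_+\sigma_-,\rho_A\}\big]+\tfrac12\gamma_3(t)\big[\sigma_z\rho_A\sigma_z-\rho_A\big],$$ with real-valued time-dependent coefficients $\Omega_A,\gamma_1,\gamma_2,\gamma_3$. Put $\gamma_\pm(t)=\gamma_1(t)\pm\gamma_2(t)$ and $\Gamma(t)=\gamma_3(t)+\gamma_+(t)/2$, and assume that the ratio $\gamma_-(t)/\gamma_+(t)$ is constant in time, i.e. there is a constant $z_\infty\in(-1,1)$ with $\gamma_-(t)=z_\infty\gamma_+(t)$ for all $t\ge 0$. Let $\sigma_{\rm map}(t)$ be the map entropy production at time $t$. Then for every $t\ge 0$, $\sigma_{\rm map}(t)\ge 0$ if and only if the dynamics is P-divisible at time $t$.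
   Context: Notation: $\sigma_+=|1\rangle\langle 0|$, $\sigma_-=|0\rangle\langle 1|$, $\sigma_z=|1\rangle\langle1|-|0\rangle\langle 0|$. In Bloch coordinates $(x,y,z)=(\mathrm{Tr}[\rho_A\sigma_x],\mathrm{Tr}[\rho_A\sigma_y],\mathrm{Tr}[\rho_A\sigma_z])$, in a suitable rotating frame about the $z$-axis, the dynamics reads $\dot x=-\Gamma x$, $\dot y=-\Gamma y$, $\dot z=\gamma_--\gamma_+z$. P-divisibility at time $t$: the dynamics is P-divisible at time $t$ if and only if $|\gamma_-(t)|\le\gamma_+(t)$ and, in case $2\Gamma(t)\le\gamma_+(t)$, also $\gamma_-(t)^2\le 4\Gamma(t)(\gamma_+(t)-\Gamma(t))$. (Equivalently, $\dot r\le 0$ at every pure state, i.e. at every point with $r=1$, where $r=\sqrt{x^2+y^2+z^2}$.) This characterization is taken as the definition. Map entropy production: let $\rho_A^{fp}(t)$ be the instantaneous fixed point, $\mathcal L_t\rho_A^{fp}(t)=0$, here the state with Bloch vector $(0,0,z_\infty)$. Define $$\sigma_{\rm map}(t)=\inf_{\rho_A}\Big\{-\mathrm{Tr}\big[\mathcal L_t\rho_A\,(\ln\rho_A-\ln\rho_A^{fp}(t))\big]\Big\},$$ the infimum (in the extended reals) being over all qubit states. In terms of $\ell=\sqrt{x^2+y^2}$ and $z$, ranging over $\{(\ell,z):\ell\ge 0,\ \ell^2+z^2\le 1\}$, with $r=\sqrt{\ell^2+z^2}$, the quantity in braces equals, for $r<1$, $$\Gamma\,\ell^2f(r)+\gamma_+(z_\infty-z)\big(z_\infty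 f(z_\infty)-zf(r)\big)=-\dot r\,L(r)+\dot z\,L(z_\infty),$$ where $L(s)=\frac12\ln\frac{1+s}{1-s}$, $f(s)=L(s)/s$, $f(0)=1$, $\dot z=\gamma_+(z_\infty-z)$, $\dot r=\frac1r(-\Gamma\ell^2+z\dot z)$ (the last expression being used for $r\neq0$). At $r=1$ its value is $+\infty$ if $\dot r<0$, $-\infty$ if $\dot r>0$, and $\dot z L(z_\infty)$ if $\dot r=0$. *)

theory Defs
  imports "HOL-Analysis.Analysis"
begin

section \<open>Complex matrices\<close>

definition cscale :: "complex \<Rightarrow> complex^'n^'m \<Rightarrow> complex^'n^'m"  (infixr \<open>*\<^sub>M\<close> 75)
  where "c *\<^sub>M A = (\<chi> i j. c * A $ i $ j)"

definition dagger :: "complex^'n^'m \<Rightarrow> complex^'m^'n"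
  where "dagger A = (\<chi> i j. cnj (A $ j $ i))"

definition hermitian :: "complex^'n^'n \<Rightarrow> bool"
  where "hermitian A \<longleftrightarrow> dagger A = A"

definition unitary :: "complex^'n^'n \<Rightarrow> bool"
  where "unitary U \<longleftrightarrow> dagger U ** U = mat 1 \<and> U ** dagger U = mat 1"

definition positive_semidefinite :: "complex^'n^'n \<Rightarrow> bool"
  where "positive_semidefinite A \<longleftrightarrow>
    hermitian A \<and> (\<forall>v. 0 \<le> Re (\<Sum>i\<in>UNIV. cnj (v $ i) * (A *v v) $ i))"

definition commutator :: "complex^'n^'n \<Rightarrow> complex^'n^'n \<Rightarrow> complex^'n^'n"
  where "commutator A B = A ** B - B ** A"

definition anticommutator :: "complex^'n^'n \<Rightarrow> complex^'n^'n \<Rightarrow> complex^'n^'n"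
  where "anticommutator A B = A ** B + B ** A"

definition real_diag :: "('n \<Rightarrow> real) \<Rightarrow> complex^'n^'n"
  where "real_diag d = (\<chi> i j. if i = j then complex_of_real (d i) else 0)"

text \<open>
  Functional calculus for positive definite Hermitian matrices only. Lemma
  \<open>hermitian_ln_eq\<close> below shows that the logarithm does not depend on the diagonalisation.
\<close>

definition hermitian_ln :: "complex^'n^'n \<Rightarrow> complex^'n^'n"
  where "hermitian_ln A = (THE H. \<exists>U d. unitary U \<and> (\<forall>i. 0 < d i) \<and>
    A = U ** real_diag d ** dagger U \<and> H = U ** real_diag (\<lambda>i. ln (d i)) ** dagger U)"

lemma hermitian_ln_eq:
  fixes U :: "complex^'n^'n"
  assumes U: "unitary U" and d: "\<And>i. 0 < d i"
  shows "hermitian_ln (U ** real_diag d ** dagger U) =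
    U ** real_diag (\<lambda>i. ln (d i)) ** dagger U"
proof -
  have entry_left: "(real_diag e ** W) $ i $ j = complex_of_real (e i) * W $ i $ j"
    for e and W :: "complex^'n^'n" and i j
    by (simp add: real_diag_def matrix_matrix_mult_def if_distrib if_distribR cong: if_cong)
  have entry_right: "(W ** real_diag e) $ i $ j = W $ i $ j * complex_of_real (e j)"
    for e and W :: "complex^'n^'n" and i j
    by (simp add: real_diag_def matrix_matrix_mult_def if_distrib if_distribR cong: if_cong)
  have uniq: "V ** real_diag (\<lambda>i. ln (e i)) ** dagger V =
      U ** real_diag (\<lambda>i. ln (d i)) ** dagger U"
    if V: "unitary V" and e: "\<forall>i. 0 < e i"
      and eq: "U ** real_diag d ** dagger U = V ** real_diag e ** dagger V"
    for V :: "complex^'n^'n" and e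
  proof -
    define W where "W = dagger V ** U"
    have UU: "dagger U ** U = mat 1" "U ** dagger U = mat 1"
      and VV: "dagger V ** V = mat 1" "V ** dagger V = mat 1"
      using U V by (auto simp: unitary_def)
    have "dagger V ** (U ** real_diag d ** dagger U) ** U =
        dagger V ** (V ** real_diag e ** dagger V) ** U"
      by (simp only: eq)
    moreover have "dagger V ** (U ** real_diag d ** dagger U) ** U =
        W ** real_diag d ** (dagger U ** U)"
      by (simp add: W_def matrix_mul_assoc)
    moreover have "dagger V ** (V ** real_diag e ** dagger V) ** U =
        (dagger V ** V) ** real_diag e ** W"
      by (simp add: W_def matrix_mul_assoc)
    ultimately have comm: "W ** real_diag d = real_diag e ** W"
      by (simp add: UU VV)
    have "W $ i $ j * complex_of_real (ln (d j)) = complex_of_real (ln (e i)) * W $ i $ j" for i j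
    proof (cases "W $ i $ j = 0")
      case False
      have "W $ i $ j * complex_of_real (d j) = complex_of_real (e i) * W $ i $ j"
        using comm by (metis entry_left entry_right)
      with False have "d j = e i"
        by (metis mult.commute mult_right_cancel of_real_eq_iff)
      then show ?thesis by simp
    qed simp
    then have ln_comm: "W ** real_diag (\<lambda>i. ln (d i)) = real_diag (\<lambda>i. ln (e i)) ** W"
      by (simp add: vec_eq_iff entry_left entry_right)
    have "V ** real_diag (\<lambda>i. ln (e i)) ** dagger V =
        V ** (real_diag (\<lambda>i. ln (e i)) ** W) ** dagger U"
      by (metis (no_types) W_def UU(2) matrix_mul_assoc matrix_mul_rid)
    also have "\<dots> = V ** (W ** real_diag (\<lambda>i. ln (d i))) ** dagger U"
      by (simp only: ln_comm)
    also have "\<dots> = (V ** dagger V) ** U ** real_diag (\<lambda>i. ln (d i)) ** dagger U"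
      by (simp add: W_def matrix_mul_assoc)
    finally show ?thesis by (simp add: VV)
  qed
  show ?thesis
    unfolding hermitian_ln_def
  proof (rule the_equality)
    show "\<exists>Ua da. unitary Ua \<and> (\<forall>i. 0 < da i) \<and>
        U ** real_diag d ** dagger U = Ua ** real_diag da ** dagger Ua \<and>
        U ** real_diag (\<lambda>i. ln (d i)) ** dagger U =
          Ua ** real_diag (\<lambda>i. ln (da i)) ** dagger Ua"
      using U d by blast
  qed (use uniq in blast)
qed

section \<open>Qubits\<close>

text \<open>
  The index type \<^typ>\<open>2\<close> has exactly the elements \<open>0\<close> and \<open>1\<close>; they label the basis vectors
  \<open>|0\<rangle>\<close> and \<open>|1\<rangle>\<close>. Since \<open>\<sigma>\<^sub>z = |1\<rangle>\<langle>1| - |0\<rangle>\<langle>0|\<close>, the Pauli matrices have their textbook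
  entries with respect to the ordered basis \<open>(|1\<rangle>, |0\<rangle>)\<close>.
\<close>

definition ketbra :: "2 \<Rightarrow> 2 \<Rightarrow> complex^2^2"
  where "ketbra a b = (\<chi> i j. if i = a \<and> j = b then 1 else 0)"

definition sigma_plus :: "complex^2^2" where "sigma_plus = ketbra 1 0"
definition sigma_minus :: "complex^2^2" where "sigma_minus = ketbra 0 1"
definition sigma_x :: "complex^2^2" where "sigma_x = ketbra 1 0 + ketbra 0 1"
definition sigma_y :: "complex^2^2" where "sigma_y = \<i> *\<^sub>M (ketbra 0 1 - ketbra 1 0)"
definition sigma_z :: "complex^2^2" where "sigma_z = ketbra 1 1 - ketbra 0 0"

definition qubit_states :: "(complex^2^2) set"
  where "qubit_states = {\<rho>. positive_semidefinite \<rho> \<and> trace \<rho> = 1}"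

definition bloch_x :: "complex^2^2 \<Rightarrow> real" where "bloch_x A = Re (trace (A ** sigma_x))"
definition bloch_y :: "complex^2^2 \<Rightarrow> real" where "bloch_y A = Re (trace (A ** sigma_y))"
definition bloch_z :: "complex^2^2 \<Rightarrow> real" where "bloch_z A = Re (trace (A ** sigma_z))"

definition bloch_radius :: "complex^2^2 \<Rightarrow> real"
  where "bloch_radius \<rho> = sqrt ((bloch_x \<rho>)\<^sup>2 + (bloch_y \<rho>)\<^sup>2 + (bloch_z \<rho>)\<^sup>2)"

definition bloch_state :: "real \<Rightarrow> real \<Rightarrow> real \<Rightarrow> complex^2^2"
  where "bloch_state x y z = (1/2) *\<^sub>R (mat 1 + x *\<^sub>R sigma_x + y *\<^sub>R sigma_y + z *\<^sub>R sigma_z)"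

section \<open>Phase-covariant dynamics\<close>

definition phase_covariant_generator ::
    "real \<Rightarrow> real \<Rightarrow> real \<Rightarrow> real \<Rightarrow> real \<Rightarrow> complex^2^2 \<Rightarrow> complex^2^2"
  where "phase_covariant_generator hbar \<Omega> \<gamma>1 \<gamma>2 \<gamma>3 \<rho> =
    (- \<i> / complex_of_real hbar) *\<^sub>M commutator (\<Omega> *\<^sub>R (sigma_plus ** sigma_minus)) \<rho>
    + \<gamma>1 *\<^sub>R (sigma_plus ** \<rho> ** sigma_minus
              - (1/2) *\<^sub>R anticommutator (sigma_minus ** sigma_plus) \<rho>)
    + \<gamma>2 *\<^sub>R (sigma_minus ** \<rho> ** sigma_plus
              - (1/2) *\<^sub>R anticommutator (sigma_plus ** sigma_minus) \<rho>)
    + (\<gamma>3 / 2) *\<^sub>R (sigma_z ** \<rho> ** sigma_z - \<rho>)"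

text \<open>The scalar arguments of the following definition are the rates at the time considered.\<close>

definition p_divisible :: "real \<Rightarrow> real \<Rightarrow> real \<Rightarrow> bool"
  where "p_divisible \<gamma>1 \<gamma>2 \<gamma>3 \<longleftrightarrow>
    (let \<gamma>p = \<gamma>1 + \<gamma>2; \<gamma>m = \<gamma>1 - \<gamma>2; \<Gamma> = \<gamma>3 + \<gamma>p / 2
     in \<bar>\<gamma>m\<bar> \<le> \<gamma>p \<and> (2 * \<Gamma> \<le> \<gamma>p \<longrightarrow> \<gamma>m\<^sup>2 \<le> 4 * \<Gamma> * (\<gamma>p - \<Gamma>)))"

section \<open>Map entropy production\<close>

text \<open>
  Time derivative of the Bloch radius along \<open>\<rho>' = L \<rho>\<close>, where the Bloch coordinates of \<open>\<rho>\<close>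
  change at the rates \<open>Tr[(L \<rho>) \<sigma>]\<close>; meaningful only at a nonzero radius.
\<close>

definition bloch_radius_rate :: "(complex^2^2 \<Rightarrow> complex^2^2) \<Rightarrow> complex^2^2 \<Rightarrow> real"
  where "bloch_radius_rate L \<rho> =
    (bloch_x \<rho> * bloch_x (L \<rho>) + bloch_y \<rho> * bloch_y (L \<rho>) + bloch_z \<rho> * bloch_z (L \<rho>))
      / bloch_radius \<rho>"

text \<open>
  The second argument is the \<open>z\<close>-coordinate of the fixed point of \<open>L\<close>, which lies on the
  \<open>z\<close>-axis. For a pure state \<open>\<rho>\<close> (radius 1), \<open>ln \<rho>\<close> does not exist as a matrix, and the value is
  fixed by convention. The trace is real for the generators above, so \<open>Re\<close> only adjusts the type.
  Note that \<open>artanh s = ln ((1 + s) / (1 - s)) / 2\<close>.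
\<close>

definition entropy_production_rate ::
    "(complex^2^2 \<Rightarrow> complex^2^2) \<Rightarrow> real \<Rightarrow> complex^2^2 \<Rightarrow> ereal"
  where "entropy_production_rate L z_inf \<rho> =
    (if bloch_radius \<rho> < 1
     then ereal (- Re (trace (L \<rho> ** (hermitian_ln \<rho> - hermitian_ln (bloch_state 0 0 z_inf)))))
     else if bloch_radius_rate L \<rho> < 0 then \<infinity>
     else if bloch_radius_rate L \<rho> > 0 then -\<infinity>
     else ereal (bloch_z (L \<rho>) * artanh z_inf))"

definition map_entropy_production :: "(complex^2^2 \<Rightarrow> complex^2^2) \<Rightarrow> real \<Rightarrow> ereal"
  where "map_entropy_production L z_inf =
    (INF \<rho>\<in>qubit_states. entropy_production_rate L z_inf \<rho>)"

section \<open>Bloch form of the generator\<close>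

lemma two_zero: "(2::2) = 0" by simp

lemmas qubit_entry_defs =
  phase_covariant_generator_def commutator_def anticommutator_def cscale_def
  sigma_plus_def sigma_minus_def sigma_x_def sigma_y_def sigma_z_def ketbra_def
  matrix_matrix_mult_def trace_def bloch_x_def bloch_y_def bloch_z_def bloch_state_def mat_def

lemma phase_covariant_fixed_point:
  assumes "\<gamma>1 - \<gamma>2 = z_inf * (\<gamma>1 + \<gamma>2)"
  shows "phase_covariant_generator hbar \<Omega> \<gamma>1 \<gamma>2 \<gamma>3 (bloch_state 0 0 z_inf) = 0"
  using assms
  by (auto simp: qubit_entry_defs vec_eq_iff forall_2 UNIV_2 two_zero complex_eq_iff)
     (auto simp: algebra_simps)

lemma bloch_z_rate:
  assumes "trace \<rho> = 1"
  shows "bloch_z (phase_covariant_generator hbar \<Omega> \<gamma>1 \<gamma>2 \<gamma>3 \<rho>) =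
    (\<gamma>1 - \<gamma>2) - (\<gamma>1 + \<gamma>2) * bloch_z \<rho>"
proof -
  have "Re (\<rho> $ 0 $ 0) = 1 - Re (\<rho> $ 1 $ 1)"
    using assms by (simp add: trace_def UNIV_2 two_zero complex_eq_iff)
  then show ?thesis
    by (simp add: qubit_entry_defs UNIV_2 two_zero) (simp add: field_simps)
qed

lemma bloch_xy_rate:
  fixes hbar \<Omega> \<gamma>1 \<gamma>2 \<gamma>3 :: real
  defines "L \<equiv> phase_covariant_generator hbar \<Omega> \<gamma>1 \<gamma>2 \<gamma>3"
    and "\<Gamma> \<equiv> \<gamma>3 + (\<gamma>1 + \<gamma>2) / 2"
  shows "bloch_x (L \<rho>) = - \<Gamma> * bloch_x \<rho> - \<Omega> / hbar * bloch_y \<rho>"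
    and "bloch_y (L \<rho>) = - \<Gamma> * bloch_y \<rho> + \<Omega> / hbar * bloch_x \<rho>"
  unfolding L_def \<Gamma>_def
  by (simp_all add: qubit_entry_defs UNIV_2 two_zero) (simp_all add: field_split_simps)

end

(* Write g = gamma_+, w = z_inf and s = sqrt (1 - w^2). P-divisibility amounts to g >= 0 and
   2 Gamma >= g (1 - s). If it fails, the pure state with z = 1 (when g < 0) or z = w / (1 + s)
   (otherwise, the tangency point at the critical Gamma) has an increasing Bloch radius, so the
   infimum is -infinity. If it holds, the production is increasing in Gamma, so for r < 1 one may
   take 2 Gamma = g (1 - s), and w >= 0 by symmetry. Both terms of the production are then
   nonnegative unless 0 < z < w and z f(r) > w f(w). In that range the production is a quadratic
   in z; either its vertex lies to the right of w, and the value at z = w is nonnegative, or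
   f(w) <= s f(r), and its discriminant is nonpositive because
   f(r) sqrt (1 - r^2) <= 1 <= f(w). *)

theory Submission
  imports Defs
begin

section \<open>Elementary bounds on \<open>artanh\<close>\<close>

lemma artanh_ge_self:
  fixes x :: real
  assumes "0 \<le> x" "x < 1"
  shows "x \<le> artanh x"
proof -
  have "artanh 0 - 0 \<le> artanh x - x"
  proof (rule DERIV_nonneg_imp_nondecreasing[OF assms(1)])
    fix t :: real assume t: "0 \<le> t" "t \<le> x"
    then have "t\<^sup>2 < 1" using assms by (simp add: power_less_one_iff abs_square_less_1)
    moreover have "((\<lambda>t. artanh t - t) has_real_derivative 1 / (1 - t\<^sup>2) - 1) (at t)"
      using t assms by (auto intro!: derivative_eq_intros)
    ultimately show "\<exists>d. ((\<lambda>t. artanh t - t) has_real_derivative d) (at t) \<and> 0 \<le> d"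
      by (intro exI[of _ "1 / (1 - t\<^sup>2) - 1"]) (auto simp: field_simps)
  qed
  then show ?thesis by simp
qed

text \<open>With u = sqrt (1 - t^2), the quotient has derivative 1 / u^3 and \<open>artanh\<close>
  has 1 / u^2, where u <= 1. Read as f(r) sqrt (1 - r^2) <= 1, the bound later controls a
  discriminant.\<close>

lemma artanh_le_div_sqrt:
  fixes x :: real
  assumes "0 \<le> x" "x < 1"
  shows "artanh x \<le> x / sqrt (1 - x\<^sup>2)"
proof -
  have "0 / sqrt (1 - 0\<^sup>2) - artanh 0 \<le> x / sqrt (1 - x\<^sup>2) - artanh x"
  proof (rule DERIV_nonneg_imp_nondecreasing[OF assms(1)])
    fix t :: real assume t: "0 \<le> t" "t \<le> x"
    define u where "u = sqrt (1 - t\<^sup>2)"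
    have lt: "t\<^sup>2 < 1" using t assms by (simp add: abs_square_less_1)
    then have u: "0 < u" "u \<le> 1" and u2: "u\<^sup>2 = 1 - t\<^sup>2" by (auto simp: u_def)
    have "((\<lambda>t. sqrt (1 - t\<^sup>2)) has_real_derivative - t / u) (at t)"
      unfolding u_def using lt by (auto intro!: derivative_eq_intros simp: field_simps)
    from DERIV_divide[OF DERIV_ident this]
    have "((\<lambda>t. t / sqrt (1 - t\<^sup>2)) has_real_derivative (u + t * t / u) / u\<^sup>2) (at t)"
      unfolding u_def[symmetric] using u by (simp add: power2_eq_square)
    then have "((\<lambda>t. t / sqrt (1 - t\<^sup>2) - artanh t) has_real_derivative
        (u + t * t / u) / u\<^sup>2 - 1 / (1 - t\<^sup>2)) (at t)"
      using t assms by (intro DERIV_diff artanh_real_has_field_derivative) auto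
    moreover have "(u + t * t / u) / u\<^sup>2 = 1 / u ^ 3"
      using u u2 by (simp add: field_simps power2_eq_square power3_eq_cube)
    moreover have "1 / u\<^sup>2 \<le> 1 / u ^ 3"
      using u by (intro divide_left_mono power_decreasing) auto
    ultimately show "\<exists>d. ((\<lambda>t. t / sqrt (1 - t\<^sup>2) - artanh t) has_real_derivative d) (at t) \<and> 0 \<le> d"
      using u2 by (metis diff_ge_0_iff_ge)
  qed
  then show ?thesis by simp
qed

text \<open>The derivative has the sign of t / (1 - t^2) - artanh t, which
  \<open>artanh_le_div_sqrt\<close> settles because 1 - t^2 <= sqrt (1 - t^2).\<close>

lemma artanh_div_self_mono:
  fixes w r :: real
  assumes "0 < w" "w \<le> r" "r < 1"
  shows "artanh w / w \<le> artanh r / r"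
proof (rule DERIV_nonneg_imp_nondecreasing[OF assms(2)])
  fix t :: real assume t: "w \<le> t" "t \<le> r"
  then have t01: "0 < t" "t < 1" using assms by auto
  then have lt: "t\<^sup>2 < 1" by (simp add: abs_square_less_1)
  have "((\<lambda>t. artanh t / t) has_real_derivative (1 / (1 - t\<^sup>2) * t - artanh t) / t\<^sup>2) (at t)"
    using t01 by (auto intro!: derivative_eq_intros simp: power2_eq_square)
  moreover have "artanh t \<le> t / (1 - t\<^sup>2)"
  proof -
    have "1 - t\<^sup>2 \<le> sqrt (1 - t\<^sup>2)"
      using lt by (intro real_le_rsqrt) (simp add: power2_eq_square mult_left_le)
    then have "t / sqrt (1 - t\<^sup>2) \<le> t / (1 - t\<^sup>2)"
      using t01 lt by (intro divide_left_mono) auto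
    with artanh_le_div_sqrt[of t] t01 show ?thesis by linarith
  qed
  ultimately show "\<exists>d. ((\<lambda>t. artanh t / t) has_real_derivative d) (at t) \<and> 0 \<le> d"
    by (intro exI conjI) (auto simp: field_simps)
qed

section \<open>P-divisibility as a threshold for Gamma\<close>

lemma p_divisible_iff:
  fixes \<gamma>1 \<gamma>2 \<gamma>3 w :: real
  assumes w: "\<bar>w\<bar> < 1" and m: "\<gamma>1 - \<gamma>2 = w * (\<gamma>1 + \<gamma>2)"
  shows "p_divisible \<gamma>1 \<gamma>2 \<gamma>3 \<longleftrightarrow>
    0 \<le> \<gamma>1 + \<gamma>2 \<and> (\<gamma>1 + \<gamma>2) * (1 - sqrt (1 - w\<^sup>2)) \<le> 2 * (\<gamma>3 + (\<gamma>1 + \<gamma>2) / 2)"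
proof -
  define g G s where "g = \<gamma>1 + \<gamma>2" and "G = \<gamma>3 + (\<gamma>1 + \<gamma>2) / 2" and "s = sqrt (1 - w\<^sup>2)"
  have "w\<^sup>2 < 1" using w by (simp add: abs_square_less_1)
  then have s: "0 < s" "s\<^sup>2 = 1 - w\<^sup>2" by (auto simp: s_def)
  have 1: "\<bar>w * g\<bar> \<le> g \<longleftrightarrow> 0 \<le> g"
  proof
    assume "0 \<le> g"
    then show "\<bar>w * g\<bar> \<le> g" using w by (simp add: abs_mult mult_left_le_one_le)
  qed auto
  have 2: "(2 * G \<le> g \<longrightarrow> (w * g)\<^sup>2 \<le> 4 * G * (g - G)) \<longleftrightarrow> g * (1 - s) \<le> 2 * G" if g: "0 \<le> g"
  proof (cases "2 * G \<le> g")
    case True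
    have "(w * g)\<^sup>2 \<le> 4 * G * (g - G) \<longleftrightarrow> (g - 2 * G)\<^sup>2 \<le> (g * s)\<^sup>2"
      unfolding power_mult_distrib s(2) by (simp add: power2_eq_square algebra_simps)
    also have "\<dots> \<longleftrightarrow> g - 2 * G \<le> g * s"
      using True g s by (intro power_mono_iff) auto
    finally show ?thesis using True by (auto simp: algebra_simps)
  next
    \<comment> \<open>The implication is vacuous here, and g (1 - s) <= g < 2 G.\<close>
    case False
    moreover have "0 \<le> g * s" using g s by simp
    ultimately show ?thesis by (simp add: algebra_simps)
  qed
  show ?thesis
    unfolding p_divisible_def Let_def m G_def[symmetric] s_def[symmetric] unfolding g_def[symmetric]
    using 1 2 by blast
qed

section \<open>Production in the interior of the Bloch ball\<close>

lemma quadratic_bound: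
  fixes f F w z r s :: real
  assumes w: "0 < w" "w \<le> r" and z: "z \<le> w" and s: "0 < s" "s \<le> 1" "s\<^sup>2 = 1 - w\<^sup>2"
    and F: "1 \<le> F" and f: "0 < f" "f\<^sup>2 * (1 - r\<^sup>2) \<le> 1"
  shows "0 \<le> f * ((1 - s) / 2 * (r\<^sup>2 - z\<^sup>2) - z * (w - z)) + (w - z) * (w * F)" (is "0 \<le> ?Q")
\<comment> \<open>With f = f(r) and F = f(w), \<open>?Q\<close> is the production divided by
  \<open>g\<close> at the critical G = g (1 - s) / 2. As a quadratic in \<open>z\<close> it has
  leading coefficient f (1 + s) / 2 and vertex w (f + F) / (f (1 + s)); the split decides on which
  side of \<open>w\<close> the vertex lies.\<close>
proof (cases "F \<le> s * f")
  case True
  have "F * F \<le> s * f * F" using True F by (intro mult_right_mono) auto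
  moreover have "1 \<le> F\<^sup>2" using F by simp
  ultimately have "f\<^sup>2 * (1 - r\<^sup>2) + F\<^sup>2 \<le> 2 * s * f * F"
    using f by (simp add: power2_eq_square)
  then have "0 \<le> w\<^sup>2 * (2 * s * f * F - f\<^sup>2 * (1 - r\<^sup>2) - F\<^sup>2)" by simp
  \<comment> \<open>Completing the square; the last summand is minus the discriminant, nonnegative
    since f^2 (1 - r^2) <= 1 <= F^2 <= s f F.\<close>
  moreover have "2 * f * (1 + s) * ?Q =
      (f * (1 + s) * z - w * (f + F))\<^sup>2 + w\<^sup>2 * (2 * s * f * F - f\<^sup>2 * (1 - r\<^sup>2) - F\<^sup>2)"
    using s(3) by algebra
  ultimately have "0 \<le> 2 * f * (1 + s) * ?Q" by simp
  moreover have "0 < 2 * f * (1 + s)" using f s by simp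
  ultimately show ?thesis using zero_le_mult_iff[of "2 * f * (1 + s)" ?Q] by linarith
next
  case False
  \<comment> \<open>The vertex lies to the right of \<open>w\<close>, so \<open>?Q\<close> decreases
    up to z = w, where its value is f (1 - s) / 2 (r^2 - w^2).\<close>
  have "f * (1 + s) / 2 * (w + z) \<le> f * (1 + s) / 2 * (2 * w)"
    using f s z by (intro mult_left_mono) auto
  also have "\<dots> \<le> (f + F) * w" using False w by (simp add: algebra_simps)
  finally have "0 \<le> (w - z) * ((f + F) * w - f * (1 + s) / 2 * (w + z))"
    using z by simp
  moreover have "0 \<le> f * ((1 - s) / 2) * (r\<^sup>2 - w\<^sup>2)"
    using f s w by (simp add: power_mono)
  moreover have "?Q = (w - z) * ((f + F) * w - f * (1 + s) / 2 * (w + z))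
      + f * ((1 - s) / 2) * (r\<^sup>2 - w\<^sup>2)" by (simp add: power2_eq_square field_simps)
  ultimately show ?thesis by linarith
qed

text \<open>The expression is -r' L(r) + z' L(w), with ell^2 written as r^2 - z^2 and the factor 1 /
  r of r' moved to L(r).\<close>

lemma interior_production_nonneg_pos:
  fixes w z r g G :: real
  assumes w: "0 \<le> w" "w < 1" and r: "0 < r" "r < 1" and z: "z\<^sup>2 \<le> r\<^sup>2"
    and g: "0 \<le> g" and G: "g * (1 - sqrt (1 - w\<^sup>2)) \<le> 2 * G"
  shows "0 \<le> artanh r / r * (G * (r\<^sup>2 - z\<^sup>2) - z * (g * (w - z))) + g * (w - z) * artanh w"
proof -
  define s f where "s = sqrt (1 - w\<^sup>2)" and "f = artanh r / r"
  have "w\<^sup>2 < 1" using w by (simp add: abs_square_less_1)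
  then have s: "0 < s" "s \<le> 1" "s\<^sup>2 = 1 - w\<^sup>2" by (auto simp: s_def)
  have f: "0 < f" using artanh_ge_self[of r] r by (simp add: f_def)
  have aw: "0 \<le> artanh w" using artanh_ge_self[of w] w by simp
  have zr: "\<bar>z\<bar> \<le> r" using z r by (simp add: power2_le_iff_abs_le)
  have mono: "w * f \<ge> artanh w" if "w \<le> r"
  proof (cases "w = 0")
    case False
    then show ?thesis using artanh_div_self_mono[of w r] w r that by (simp add: f_def field_simps)
  qed simp
  \<comment> \<open>The claim at the critical \<open>G\<close>, divided by \<open>g\<close>;
    multiplying back at the end also covers g = 0.\<close>
  have key: "0 \<le> f * ((1 - s) / 2 * (r\<^sup>2 - z\<^sup>2) - z * (w - z)) + (w - z) * artanh w" (is "0 \<le> ?Q")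
  proof -
    \<comment> \<open>The first summand is nonnegative, so only opposite signs of w - z and artanh w
      - z f can do harm.\<close>
    have split: "?Q = f * ((1 - s) / 2 * (r\<^sup>2 - z\<^sup>2)) + (w - z) * (artanh w - z * f)"
      by (simp add: algebra_simps)
    have 0: "0 \<le> f * ((1 - s) / 2 * (r\<^sup>2 - z\<^sup>2))" using f s z by simp
    consider "w \<le> z" | "z < w" "z * f \<le> artanh w" | "z < w" "artanh w < z * f" by linarith
    then show ?thesis
    proof cases
      case 1
      then have "w * f \<le> z * f" using f by simp
      then have "artanh w \<le> z * f" using mono zr 1 by linarith
      then have "0 \<le> (w - z) * (artanh w - z * f)" using 1 by (simp add: mult_nonpos_nonpos)
      then show ?thesis using split 0 by simp
    next
      case 2
      then show ?thesis using split 0 by simp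
    next
      case 3
      then have wf: "artanh w < w * f" using f by (meson less_trans mult_strict_right_mono)
      have "0 < z * f" using aw 3 by linarith
      then have "0 < z" using f by (simp add: zero_less_mult_iff)
      then have w0: "0 < w" using 3 by simp
      \<comment> \<open>If \<open>r\<close> were below \<open>w\<close>, monotonicity of artanh x /
        x would give f(r) <= f(w), contrary to \<open>wf\<close>.\<close>
      have wr: "w \<le> r"
      proof (rule ccontr)
        assume "\<not> w \<le> r"
        then have "f \<le> artanh w / w" using artanh_div_self_mono[of r w] r w by (simp add: f_def)
        then show False using wf w0 by (simp add: field_simps)
      qed
      have "r\<^sup>2 < 1" using r by (simp add: abs_square_less_1)
      then have "f * sqrt (1 - r\<^sup>2) \<le> 1"
        using artanh_le_div_sqrt[of r] r by (simp add: f_def field_simps)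
      then have "(f * sqrt (1 - r\<^sup>2))\<^sup>2 \<le> 1"
        using f \<open>r\<^sup>2 < 1\<close> by (simp add: power_le_one)
      then have "f\<^sup>2 * (1 - r\<^sup>2) \<le> 1" using \<open>r\<^sup>2 < 1\<close> by (simp add: power_mult_distrib)
      moreover have "1 \<le> artanh w / w" using artanh_ge_self[of w] w0 w by simp
      ultimately show ?thesis
        using quadratic_bound[of w r z s "artanh w / w" f] w0 wr 3 s f by simp
    qed
  qed
  have "g * (1 - s) / 2 \<le> G" using G by (simp add: s_def)
  then have "g * (1 - s) / 2 * (f * (r\<^sup>2 - z\<^sup>2)) \<le> G * (f * (r\<^sup>2 - z\<^sup>2))"
    using f z by (intro mult_right_mono) auto
  moreover have "0 \<le> g * ?Q" using g key by simp
  ultimately show ?thesis by (simp add: f_def[symmetric] algebra_simps)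
qed

lemma interior_production_nonneg:
  fixes w z r g G :: real
  assumes w: "\<bar>w\<bar> < 1" and r: "0 < r" "r < 1" and z: "z\<^sup>2 \<le> r\<^sup>2"
    and g: "0 \<le> g" and G: "g * (1 - sqrt (1 - w\<^sup>2)) \<le> 2 * G"
  shows "0 \<le> artanh r / r * (G * (r\<^sup>2 - z\<^sup>2) - z * (g * (w - z))) + g * (w - z) * artanh w"
proof (cases "0 \<le> w")
  case True
  then show ?thesis using interior_production_nonneg_pos[of w r z g G] assms by simp
next
  case False
  \<comment> \<open>Replacing (w, z) by (-w, -z) leaves both products unchanged, since
    \<open>artanh\<close> is odd.\<close>
  then show ?thesis
    using interior_production_nonneg_pos[of "- w" r "- z" g G] assms
    by (simp add: artanh_minus_real algebra_simps)
qed

section \<open>Pure states, on the Bloch sphere\<close>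

lemma boundary_inward_rate_nonneg:
  fixes w z g G :: real
  assumes w: "\<bar>w\<bar> < 1" and z: "z\<^sup>2 \<le> 1"
    and g: "0 \<le> g" and G: "g * (1 - sqrt (1 - w\<^sup>2)) \<le> 2 * G"
  shows "0 \<le> G * (1 - z\<^sup>2) - z * (g * (w - z))"
proof -
  define s where "s = sqrt (1 - w\<^sup>2)"
  have "w\<^sup>2 < 1" using w by (simp add: abs_square_less_1)
  then have s: "0 < s" "s\<^sup>2 = 1 - w\<^sup>2" by (auto simp: s_def)
  have "g * (1 - s) / 2 * (1 - z\<^sup>2) \<le> G * (1 - z\<^sup>2)"
    using z G by (intro mult_right_mono) (auto simp: s_def)
  \<comment> \<open>At the critical \<open>G\<close>, minus the radial velocity is a nonnegative
    multiple of a square that vanishes at z = w / (1 + s), where the flow is tangent to the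
    sphere.\<close>
  moreover have "2 * (1 + s) * (g * (1 - s) / 2 * (1 - z\<^sup>2) - z * (g * (w - z)))
      = g * ((1 + s) * z - w)\<^sup>2"
    using s(2) by algebra
  then have "0 \<le> g * (1 - s) / 2 * (1 - z\<^sup>2) - z * (g * (w - z))"
    using s g by (smt (verit) mult_pos_neg mult_nonneg_nonneg zero_le_power2)
  ultimately show ?thesis by linarith
qed

text \<open>Zero radial velocity means z z' = G ell^2 >= 0, so for g > 0 the coordinate
  \<open>z\<close> lies between 0 and \<open>w\<close>. Hence w - z and \<open>artanh w\<close> do
  not have opposite signs. This serves the finite branch of the convention at r = 1.\<close>

lemma boundary_production_nonneg:
  fixes w z g G :: real
  assumes w: "\<bar>w\<bar> < 1" and z: "z\<^sup>2 \<le> 1"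
    and g: "0 \<le> g" and G: "0 \<le> G"
    and eq: "G * (1 - z\<^sup>2) - z * (g * (w - z)) = 0"
  shows "0 \<le> g * (w - z) * artanh w"
proof -
  have "0 \<le> G * (1 - z\<^sup>2)" using G z by simp
  then have *: "0 \<le> g * (z * (w - z))" using eq by (simp add: algebra_simps)
  consider "g = 0" | "0 < g" "0 \<le> w" | "0 < g" "w < 0" using g by linarith
  then show ?thesis
  proof cases
    case 2
    then have "0 \<le> z * (w - z)" using * by (simp add: zero_le_mult_iff)
    then have "z \<le> w" using 2 by (smt (verit) mult_pos_neg)
    moreover have "0 \<le> artanh w" using artanh_ge_self[of w] 2 w by simp
    ultimately show ?thesis using g by simp
  next
    case 3
    then have "0 \<le> z * (w - z)" using * by (simp add: zero_le_mult_iff)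
    then have "w \<le> z" using 3 by (smt (verit) mult_neg_pos)
    moreover have "artanh w \<le> 0"
      using artanh_ge_self[of "- w"] 3 w by (simp add: artanh_minus_real)
    ultimately show ?thesis using g by (simp add: mult_nonneg_nonpos mult_nonpos_nonpos)
  qed simp
qed

lemma not_p_divisible_witness:
  fixes w g G :: real
  assumes w: "\<bar>w\<bar> < 1" and n: "\<not> (0 \<le> g \<and> g * (1 - sqrt (1 - w\<^sup>2)) \<le> 2 * G)"
  obtains z where "z\<^sup>2 \<le> 1" "G * (1 - z\<^sup>2) - z * (g * (w - z)) < 0"
proof (cases "0 \<le> g")
  case False
  \<comment> \<open>At the pole z = 1 the axial velocity g (w - 1) points outward.\<close>
  then have "g * (1 - w) < 0" using w by (simp add: mult_neg_pos)
  then show thesis using that[of 1] by (simp add: algebra_simps)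
next
  case True
  define s where "s = sqrt (1 - w\<^sup>2)"
  have "w\<^sup>2 < 1" using w by (simp add: abs_square_less_1)
  then have s: "0 < s" "s\<^sup>2 = 1 - w\<^sup>2" by (auto simp: s_def)
  \<comment> \<open>The zero of the square in \<open>boundary_inward_rate_nonneg\<close>: there only
    the deficit 2 G - g (1 - s) remains.\<close>
  define z where "z = w / (1 + s)"
  have z: "(1 + s) * z = w" using s by (simp add: z_def)
  have z2: "(1 + s) * z\<^sup>2 = 1 - s"
  proof -
    have "(1 + s) * ((1 + s) * z\<^sup>2) = ((1 + s) * z)\<^sup>2"
      by (simp add: power2_eq_square)
    also have "\<dots> = (1 + s) * (1 - s)"
      unfolding z using s(2) by (simp add: power2_eq_square algebra_simps)
    finally have "(1 + s) * ((1 + s) * z\<^sup>2) = (1 + s) * (1 - s)" .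
    then show ?thesis using s by simp
  qed
  have "(1 + s) * z\<^sup>2 \<le> (1 + s) * 1" using z2 s by simp
  then have "z\<^sup>2 \<le> 1" using s by simp
  moreover have "(1 + s) * (G * (1 - z\<^sup>2) - z * (g * (w - z))) = s * (2 * G - g * (1 - s))"
  proof -
    have "z * w = (1 + s) * z\<^sup>2" using z by (simp add: power2_eq_square mult.left_commute)
    then have zw: "z * w = 1 - s" using z2 by simp
    have "(1 + s) * (G * (1 - z\<^sup>2) - z * (g * (w - z))) =
        G * (1 + s - (1 + s) * z\<^sup>2) - g * ((1 + s) * (z * w) - (1 + s) * z\<^sup>2)"
      by (simp add: power2_eq_square algebra_simps)
    then show ?thesis unfolding z2 zw by (simp add: algebra_simps)
  qed
  moreover have "s * (2 * G - g * (1 - s)) < 0"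
    using s n True by (simp add: s_def mult_pos_neg)
  ultimately show thesis using that[of z] s by (smt (verit) mult_nonneg_nonneg)
qed

section \<open>Logarithms of qubit states\<close>

definition pauli :: "real \<Rightarrow> real \<Rightarrow> real \<Rightarrow> complex^2^2"
  where "pauli x y z = x *\<^sub>R sigma_x + y *\<^sub>R sigma_y + z *\<^sub>R sigma_z"

lemmas entry_simps = qubit_entry_defs pauli_def dagger_def real_diag_def unitary_def vec_eq_iff
  forall_2 UNIV_2 two_zero complex_eq_iff

text \<open>One \<open>U\<close> serves all spectra \<open>d\<close>, so the same conjugation yields
  a state and, from the logarithms of its eigenvalues, its logarithm.\<close>

lemma pauli_diagonalisation:
  fixes x y z :: real
  assumes "x\<^sup>2 + y\<^sup>2 + z\<^sup>2 = 1"
  obtains U :: "complex^2^2" where "unitary U"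
    "\<And>d. U ** real_diag d ** dagger U = ((d 1 + d 0) / 2) *\<^sub>R mat 1 + ((d 1 - d 0) / 2) *\<^sub>R pauli x y z"
proof (cases "z = - 1")
  \<comment> \<open>The half-angle formula of the other case would divide by p = 0 here; exchanging
    the basis vectors suffices.\<close>
  case True
  then have [simp]: "x = 0" "y = 0" using assms by (auto simp: sum_power2_eq_zero_iff)
  show thesis
    by (rule that[of sigma_x]) (auto simp: entry_simps True field_simps)
next
  case False
  have "z\<^sup>2 \<le> 1" using assms by (smt (verit) zero_le_power2)
  then have "\<bar>z\<bar> \<le> 1" by (simp add: abs_square_le_1)
  then have z: "0 < 1 + z" using False by linarith
  \<comment> \<open>In polar angles p = cos (theta / 2) and a + i b = exp (i phi) sin (theta / 2);
    column 1 of \<open>U\<close> is the spin state along (x, y, z), column 0 the opposite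
    one.\<close>
  define p where "p = sqrt ((1 + z) / 2)"
  have p: "0 < p" "2 * p\<^sup>2 = 1 + z" using z by (auto simp: p_def)
  define a b where "a = x / (2 * p)" and "b = y / (2 * p)"
  have xy: "x = 2 * p * a" "y = 2 * p * b" using p by (auto simp: a_def b_def)
  have zp: "z = 2 * p\<^sup>2 - 1" using p by simp
  have "4 * p\<^sup>2 * (a\<^sup>2 + b\<^sup>2 + p\<^sup>2 - 1) = 0"
    using assms unfolding xy zp by algebra
  then have ab: "a\<^sup>2 + b\<^sup>2 + p\<^sup>2 = 1" using p by simp
  define U :: "complex^2^2" where "U = p *\<^sub>R mat 1 + Complex a b *\<^sub>M ketbra 0 1 - Complex a (- b) *\<^sub>M ketbra 1 0"
  have sq: "p * p = 1 - a * a - b * b" using ab by (simp add: power2_eq_square)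
  have zz: "z = 1 - 2 * (a * a + b * b)" unfolding zp using ab by (simp add: power2_eq_square)
  \<comment> \<open>The diagonal entries of the conjugated matrix, with D = \<open>d 1\<close> and E
    = \<open>d 0\<close>.\<close>
  have diag: "p * D * p + (b * E * b + a * E * a) = (D + E) / 2 + (D - E) * (2 * p\<^sup>2 - 1) / 2"
    "a * D * a + b * D * b + p * E * p = (D + E) / 2 + (D - E) * (1 - 2 * p\<^sup>2) / 2" for D E :: real
    using ab by algebra+
  show thesis
  proof (rule that[of U])
    show "unitary U"
      by (simp add: U_def entry_simps) (simp add: sq algebra_simps)
    show "U ** real_diag d ** dagger U = ((d 1 + d 0) / 2) *\<^sub>R mat 1 + ((d 1 - d 0) / 2) *\<^sub>R pauli x y z" for d
      by (simp add: U_def entry_simps xy zp) (simp add: diag, simp add: algebra_simps)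
  qed
qed

text \<open>The eigenvalues are (1 + r) / 2 and (1 - r) / 2. The constant \<open>c\<close> stays
  unspecified because it drops out against a traceless matrix. Separating \<open>r\<close> from the
  direction admits r = 0 and, for the fixed point, negative \<open>r\<close>.\<close>

lemma hermitian_ln_bloch_state:
  fixes x y z r :: real
  assumes n: "x\<^sup>2 + y\<^sup>2 + z\<^sup>2 = 1" and r: "\<bar>r\<bar> < 1"
  obtains c where "hermitian_ln (bloch_state (r * x) (r * y) (r * z)) = c *\<^sub>R mat 1 + artanh r *\<^sub>R pauli x y z"
proof -
  obtain U :: "complex^2^2" where U: "unitary U" and diag:
    "\<And>d. U ** real_diag d ** dagger U = ((d 1 + d 0) / 2) *\<^sub>R mat 1 + ((d 1 - d 0) / 2) *\<^sub>R pauli x y z"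
    using pauli_diagonalisation[OF n] by metis
  define d :: "2 \<Rightarrow> real" where "d i = (if i = 1 then (1 + r) / 2 else (1 - r) / 2)" for i
  have d: "0 < d i" for i using r by (auto simp: d_def)
  have "bloch_state (r * x) (r * y) (r * z) = U ** real_diag d ** dagger U"
    unfolding diag by (simp add: d_def bloch_state_def pauli_def scaleR_add_right)
       (simp add: field_simps)
  then have "hermitian_ln (bloch_state (r * x) (r * y) (r * z)) =
      U ** real_diag (\<lambda>i. ln (d i)) ** dagger U"
    using hermitian_ln_eq[OF U d] by simp
  moreover have "(ln (d 1) - ln (d 0)) / 2 = artanh r"
    using r by (simp add: d_def artanh_def ln_div)
  ultimately show thesis using that unfolding diag by metis
qed

lemma trace_mult_pauli:
  "Re (trace (A ** (c *\<^sub>R mat 1 + a *\<^sub>R pauli x y z))) =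
    c * Re (trace A) + a * (x * bloch_x A + y * bloch_y A + z * bloch_z A)"
  by (simp add: qubit_entry_defs pauli_def UNIV_2 two_zero) (simp add: field_simps)

lemma trace_phase_covariant_generator:
  "trace (phase_covariant_generator hbar \<Omega> \<gamma>1 \<gamma>2 \<gamma>3 \<rho>) = 0"
  by (simp add: entry_simps)

section \<open>Qubit states and the Bloch ball\<close>

lemma qubit_state_eq_bloch_state:
  assumes "\<rho> \<in> qubit_states"
  shows "\<rho> = bloch_state (bloch_x \<rho>) (bloch_y \<rho>) (bloch_z \<rho>)"
proof -
  have tr: "Re (\<rho> $ 1 $ 1) = 1 - Re (\<rho> $ 0 $ 0)"
    using assms by (simp add: qubit_states_def trace_def UNIV_2 two_zero complex_eq_iff)
  have "dagger \<rho> $ i $ j = \<rho> $ i $ j" for i j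
    using assms by (simp add: qubit_states_def positive_semidefinite_def hermitian_def)
  from this[of 0 0] this[of 1 1] this[of 0 1]
  have "Im (\<rho> $ 0 $ 0) = 0" "Im (\<rho> $ 1 $ 1) = 0"
    "Re (\<rho> $ 1 $ 0) = Re (\<rho> $ 0 $ 1)" "Im (\<rho> $ 1 $ 0) = - Im (\<rho> $ 0 $ 1)"
    by (simp_all add: dagger_def complex_eq_iff)
  with tr show ?thesis
    by (simp add: entry_simps)
qed

lemma bloch_radius_le_1:
  assumes "\<rho> \<in> qubit_states"
  shows "bloch_radius \<rho> \<le> 1"
proof -
  define x y z r where "x = bloch_x \<rho>" and "y = bloch_y \<rho>" and "z = bloch_z \<rho>"
    and "r = bloch_radius \<rho>"
  have \<rho>: "\<rho> = bloch_state x y z"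
    using qubit_state_eq_bloch_state[OF assms] by (simp add: x_def y_def z_def)
  have r: "0 \<le> r" "r\<^sup>2 = x\<^sup>2 + y\<^sup>2 + z\<^sup>2"
    by (auto simp: r_def bloch_radius_def x_def y_def z_def)
  have psd: "0 \<le> Re (\<Sum>i\<in>UNIV. cnj (v $ i) * (\<rho> *v v) $ i)" for v
    using assms by (auto simp: qubit_states_def positive_semidefinite_def)
  show ?thesis
  proof (cases "r + z \<le> 0")
    \<comment> \<open>Here the eigenvector used in the other case vanishes, so |1> is tested
      instead.\<close>
    case True
    have "0 \<le> 1 + z"
      using psd[of "\<chi> i. if i = 1 then 1 else 0"]
      by (simp add: \<rho> entry_simps matrix_vector_mult_def)
    then show ?thesis using True unfolding r_def[symmetric] by linarith
  next
    case False
    have "0 \<le> (1 - r) * (r * (r + z))"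
    proof -
      \<comment> \<open>An unnormalised eigenvector for the eigenvalue (1 - r) / 2, with squared
        norm 2 r (r + z).\<close>
      define v :: "complex^2"
        where "v = (\<chi> i. if i = 1 then Complex x (- y) else - complex_of_real (r + z))"
      have "Re (\<Sum>i\<in>UNIV. cnj (v $ i) * (\<rho> *v v) $ i) = (1 - r) * (r * (r + z))"
      proof -
        have "2 * Re (\<Sum>i\<in>UNIV. cnj (v $ i) * (\<rho> *v v) $ i)
          = (1 + z) * (x\<^sup>2 + y\<^sup>2) - 2 * (r + z) * (x\<^sup>2 + y\<^sup>2) + (1 - z) * (r + z)\<^sup>2"
          by (simp add: v_def \<rho> entry_simps matrix_vector_mult_def power2_eq_square) (simp add: field_simps)
        also have "\<dots> = 2 * ((1 - r) * (r * (r + z)))"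
        proof -
          have q: "x\<^sup>2 + y\<^sup>2 = r\<^sup>2 - z\<^sup>2" using r(2) by simp
          show ?thesis unfolding q by (simp add: power2_eq_square algebra_simps)
        qed
        finally show ?thesis by simp
      qed
      then show ?thesis using psd[of v] by (simp only:)
    qed
    moreover have "r \<noteq> 0"
    proof
      assume "r = 0"
      with r(2) have "z = 0" by (simp add: add_nonneg_eq_0_iff)
      with \<open>r = 0\<close> False show False by simp
    qed
    then have "0 < r * (r + z)" using False r by simp
    ultimately have "0 \<le> 1 - r" using zero_le_mult_iff[of "1 - r" "r * (r + z)"] by linarith
    then show ?thesis by (simp add: r_def)
  qed
qed

lemma bloch_coordinates_bloch_state [simp]:
  "bloch_x (bloch_state x y z) = x" "bloch_y (bloch_state x y z) = y"
  "bloch_z (bloch_state x y z) = z" "trace (bloch_state x y z) = 1"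
  by (simp_all add: qubit_entry_defs UNIV_2 two_zero complex_eq_iff) (simp_all add: field_simps)

text \<open>The state projects onto the vector with half-angle entries \<open>p\<close> and
  \<open>q\<close>, so its quadratic form is |p v_1 + q v_0|^2. By symmetry about the z-axis, y = 0
  is enough for the witnesses.\<close>

lemma pure_bloch_state_in_qubit_states:
  assumes "x\<^sup>2 + z\<^sup>2 = 1" "0 \<le> x"
  shows "bloch_state x 0 z \<in> qubit_states"
proof -
  define p q where "p = sqrt ((1 + z) / 2)" and "q = sqrt ((1 - z) / 2)"
  have "z\<^sup>2 \<le> 1" using assms by (smt (verit) zero_le_power2)
  then have z: "\<bar>z\<bar> \<le> 1" by (simp add: abs_square_le_1)
  then have pq: "p\<^sup>2 = (1 + z) / 2" "q\<^sup>2 = (1 - z) / 2" by (auto simp: p_def q_def)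
  have "(2 * (p * q))\<^sup>2 = x\<^sup>2"
    using assms(1) by (simp add: power_mult_distrib pq) (simp add: power2_eq_square algebra_simps)
  moreover have "0 \<le> 2 * (p * q)" using z by (simp add: p_def q_def)
  ultimately have "2 * (p * q) = x" using assms(2) by (rule power2_eq_imp_eq)
  then have x: "x = 2 * (p * q)" by simp
  have "Re (\<Sum>i\<in>UNIV. cnj (v $ i) * (bloch_state x 0 z *v v) $ i) =
      (p * Re (v $ 1) + q * Re (v $ 0))\<^sup>2 + (p * Im (v $ 1) + q * Im (v $ 0))\<^sup>2" for v
  proof -
    have "2 * Re (\<Sum>i\<in>UNIV. cnj (v $ i) * (bloch_state x 0 z *v v) $ i) =
      (1 + z) * ((Re (v $ 1))\<^sup>2 + (Im (v $ 1))\<^sup>2) + (1 - z) * ((Re (v $ 0))\<^sup>2 + (Im (v $ 0))\<^sup>2)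
      + 2 * x * (Re (v $ 1) * Re (v $ 0) + Im (v $ 1) * Im (v $ 0))"
      by (simp add: qubit_entry_defs UNIV_2 two_zero matrix_vector_mult_def power2_eq_square) (simp add: field_simps)
    moreover have "1 + z = 2 * p\<^sup>2" "1 - z = 2 * q\<^sup>2" using pq by simp_all
    ultimately show ?thesis by (simp add: x power2_eq_square algebra_simps)
  qed
  moreover have "hermitian (bloch_state x 0 z)"
    by (simp add: hermitian_def entry_simps)
  ultimately show ?thesis
    by (simp add: qubit_states_def positive_semidefinite_def)
qed

section \<open>Entropy production in Bloch coordinates\<close>

lemma entropy_production_rate_interior:
  fixes hbar \<Omega> \<gamma>1 \<gamma>2 \<gamma>3 w :: real and \<rho> :: "complex^2^2"
  defines "L \<equiv> phase_covariant_generator hbar \<Omega> \<gamma>1 \<gamma>2 \<gamma>3"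
    and "r \<equiv> bloch_radius \<rho>"
  assumes \<rho>: "\<rho> \<in> qubit_states" and r: "r < 1" and w: "\<bar>w\<bar> < 1"
  shows "entropy_production_rate L w \<rho> =
    ereal (- artanh r * bloch_radius_rate L \<rho> + bloch_z (L \<rho>) * artanh w)"
proof -
  define x y z where "x = bloch_x \<rho>" and "y = bloch_y \<rho>" and "z = bloch_z \<rho>"
  have rr: "0 \<le> r" "r\<^sup>2 = x\<^sup>2 + y\<^sup>2 + z\<^sup>2"
    by (auto simp: r_def bloch_radius_def x_def y_def z_def)
  \<comment> \<open>The direction of the Bloch vector; at the centre it is arbitrary and the pole is
    taken.\<close>
  obtain a b c where n: "a\<^sup>2 + b\<^sup>2 + c\<^sup>2 = 1" "x = r * a" "y = r * b" "z = r * c"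
  proof (cases "r = 0")
    case True
    then have "x = 0" "y = 0" "z = 0"
      using rr(2) by (simp_all add: add_nonneg_eq_0_iff)
    then show thesis using that[of 0 0 1] True by simp
  next
    case False
    then have "(x / r)\<^sup>2 + (y / r)\<^sup>2 + (z / r)\<^sup>2 = 1"
      using rr(2)[symmetric] by (simp add: power_divide add_divide_distrib[symmetric])
    then show thesis using that[of "x / r" "y / r" "z / r"] False by simp
  qed
  have \<rho>': "\<rho> = bloch_state (r * a) (r * b) (r * c)"
    using qubit_state_eq_bloch_state[OF \<rho>] n by (simp add: x_def y_def z_def)
  obtain k where k: "hermitian_ln \<rho> = k *\<^sub>R mat 1 + artanh r *\<^sub>R pauli a b c"
    using hermitian_ln_bloch_state[OF n(1), of r] r rr \<rho>' by auto
  obtain m where m: "hermitian_ln (bloch_state 0 0 w) = m *\<^sub>R mat 1 + artanh w *\<^sub>R pauli 0 0 1"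
    using hermitian_ln_bloch_state[of 0 0 1 w] w by auto
  have "Re (trace (L \<rho> ** (hermitian_ln \<rho> - hermitian_ln (bloch_state 0 0 w)))) =
      Re (trace (L \<rho> ** hermitian_ln \<rho>)) - Re (trace (L \<rho> ** hermitian_ln (bloch_state 0 0 w)))"
    by (simp add: matrix_matrix_mult_def trace_def sum_subtractf right_diff_distrib)
  also have "\<dots> = artanh r * (a * bloch_x (L \<rho>) + b * bloch_y (L \<rho>) + c * bloch_z (L \<rho>))
      - artanh w * bloch_z (L \<rho>)"
    \<comment> \<open>\<open>L\<close> has traceless values, which removes the unknown
      \<open>k\<close> and \<open>m\<close>.\<close>
    unfolding k m trace_mult_pauli by (simp add: L_def trace_phase_covariant_generator)
  also have "artanh r * (a * bloch_x (L \<rho>) + b * bloch_y (L \<rho>) + c * bloch_z (L \<rho>))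
      = artanh r * bloch_radius_rate L \<rho>"
  \<comment> \<open>At r = 0 both sides vanish because artanh 0 = 0, whatever value the radius rate
    has there.\<close>
  proof (cases "r = 0")
    case False
    then show ?thesis
      unfolding bloch_radius_rate_def x_def[symmetric] y_def[symmetric] z_def[symmetric]
        r_def[symmetric]
      by (simp add: n field_simps)
  qed simp
  finally show ?thesis
    using r by (simp add: entropy_production_rate_def r_def)
qed

text \<open>The \<Omega> terms rotate about the z-axis and cancel in x x' + y y'; x^2 + y^2 then
  enters as r^2 - z^2.\<close>

lemma bloch_radius_rate_phase_covariant:
  fixes hbar \<Omega> \<gamma>1 \<gamma>2 \<gamma>3 w :: real and \<rho> :: "complex^2^2"
  assumes "trace \<rho> = 1" and "\<gamma>1 - \<gamma>2 = w * (\<gamma>1 + \<gamma>2)"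
  shows "bloch_radius_rate (phase_covariant_generator hbar \<Omega> \<gamma>1 \<gamma>2 \<gamma>3) \<rho> =
    - ((\<gamma>3 + (\<gamma>1 + \<gamma>2) / 2) * ((bloch_radius \<rho>)\<^sup>2 - (bloch_z \<rho>)\<^sup>2)
      - bloch_z \<rho> * ((\<gamma>1 + \<gamma>2) * (w - bloch_z \<rho>))) / bloch_radius \<rho>"
proof -
  have r: "(bloch_radius \<rho>)\<^sup>2 = (bloch_x \<rho>)\<^sup>2 + (bloch_y \<rho>)\<^sup>2 + (bloch_z \<rho>)\<^sup>2"
    by (simp add: bloch_radius_def)
  show ?thesis
    unfolding bloch_radius_rate_def bloch_z_rate[OF assms(1)] bloch_xy_rate assms(2) r
    by (rule arg_cong[of _ _ "\<lambda>u. u / _"]) (simp add: power2_eq_square algebra_simps)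
qed

section \<open>The infimum over all qubit states\<close>

theorem theorem1:
  fixes \<Omega> \<gamma>1 \<gamma>2 \<gamma>3 :: "real \<Rightarrow> real" and hbar z_inf t :: real
  assumes "hbar > 0"
    and "- 1 < z_inf" and "z_inf < 1"
    and "\<And>s. s \<ge> 0 \<Longrightarrow> \<gamma>1 s - \<gamma>2 s = z_inf * (\<gamma>1 s + \<gamma>2 s)"
    and "t \<ge> 0"
  shows "map_entropy_production
           (phase_covariant_generator hbar (\<Omega> t) (\<gamma>1 t) (\<gamma>2 t) (\<gamma>3 t)) z_inf \<ge> 0
         \<longleftrightarrow> p_divisible (\<gamma>1 t) (\<gamma>2 t) (\<gamma>3 t)"
proof -
  define L where "L = phase_covariant_generator hbar (\<Omega> t) (\<gamma>1 t) (\<gamma>2 t) (\<gamma>3 t)"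
  define g G where "g = \<gamma>1 t + \<gamma>2 t" and "G = \<gamma>3 t + (\<gamma>1 t + \<gamma>2 t) / 2"
  have w: "\<bar>z_inf\<bar> < 1" using assms by auto
  have m: "\<gamma>1 t - \<gamma>2 t = z_inf * (\<gamma>1 t + \<gamma>2 t)" using assms by simp
  have zdot: "bloch_z (L \<rho>) = g * (z_inf - bloch_z \<rho>)" if "trace \<rho> = 1" for \<rho>
    unfolding L_def bloch_z_rate[OF that] m by (simp add: g_def algebra_simps)
  have rdot: "bloch_radius_rate L \<rho> = - (G * ((bloch_radius \<rho>)\<^sup>2 - (bloch_z \<rho>)\<^sup>2)
      - bloch_z \<rho> * (g * (z_inf - bloch_z \<rho>))) / bloch_radius \<rho>" if "trace \<rho> = 1" for \<rho>
    unfolding L_def g_def G_def by (rule bloch_radius_rate_phase_covariant[OF that m])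
  have P: "p_divisible (\<gamma>1 t) (\<gamma>2 t) (\<gamma>3 t) \<longleftrightarrow> 0 \<le> g \<and> g * (1 - sqrt (1 - z_inf\<^sup>2)) \<le> 2 * G"
    unfolding g_def G_def by (rule p_divisible_iff[OF w m])
  \<comment> \<open>An infimum is nonnegative iff all values are, so the equivalence is proved
    statewise.\<close>
  have "(\<forall>\<rho>\<in>qubit_states. 0 \<le> entropy_production_rate L z_inf \<rho>)
      \<longleftrightarrow> 0 \<le> g \<and> g * (1 - sqrt (1 - z_inf\<^sup>2)) \<le> 2 * G" (is "?lhs \<longleftrightarrow> ?rhs")
  proof
    assume pos: ?lhs
    show ?rhs
    proof (rule ccontr)
      assume "\<not> ?rhs"
      then obtain z where z: "z\<^sup>2 \<le> 1" and neg: "G * (1 - z\<^sup>2) - z * (g * (z_inf - z)) < 0"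
        using not_p_divisible_witness[OF w] by blast
      \<comment> \<open>The point of the unit sphere at height \<open>z\<close> in the plane y = 0,
        where the convention for r = 1 applies.\<close>
      define \<rho> where "\<rho> = bloch_state (sqrt (1 - z\<^sup>2)) 0 z"
      have r: "bloch_radius \<rho> = 1" using z by (simp add: bloch_radius_def \<rho>_def)
      have "0 < bloch_radius_rate L \<rho>"
        using rdot[of \<rho>] r neg by (simp add: \<rho>_def)
      then have "entropy_production_rate L z_inf \<rho> = - \<infinity>"
        using r by (simp add: entropy_production_rate_def)
      moreover have "\<rho> \<in> qubit_states"
        unfolding \<rho>_def using z by (intro pure_bloch_state_in_qubit_states) auto
      ultimately show False using pos by fastforce
    qed
  next
    assume rhs: ?rhs
    show ?lhs
    proof
      fix \<rho> assume \<rho>: "\<rho> \<in> qubit_states"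
      define z r where "z = bloch_z \<rho>" and "r = bloch_radius \<rho>"
      have tr: "trace \<rho> = 1" using \<rho> by (simp add: qubit_states_def)
      have r: "0 \<le> r" "r \<le> 1" "z\<^sup>2 \<le> r\<^sup>2"
        using bloch_radius_le_1[OF \<rho>] by (auto simp: r_def z_def bloch_radius_def)
      have zd: "bloch_z (L \<rho>) = g * (z_inf - z)" using zdot[OF tr] by (simp add: z_def)
      have rd: "bloch_radius_rate L \<rho> = - (G * (r\<^sup>2 - z\<^sup>2) - z * (g * (z_inf - z))) / r"
        using rdot[OF tr] by (simp add: z_def r_def)
      show "0 \<le> entropy_production_rate L z_inf \<rho>"
      proof (cases "r < 1")
        case True
        have "0 \<le> - artanh r * bloch_radius_rate L \<rho> + bloch_z (L \<rho>) * artanh z_inf"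
        proof (cases "r = 0")
          case r0: True
          \<comment> \<open>At the centre only g w L(w) survives, and w L(w) >= 0.\<close>
          then have "z = 0" using r by simp
          moreover have "0 \<le> z_inf * artanh z_inf"
            using artanh_ge_self[of z_inf] artanh_ge_self[of "- z_inf"] w
            by (cases "0 \<le> z_inf") (auto simp: artanh_minus_real mult_nonpos_nonpos)
          ultimately show ?thesis using r0 rhs unfolding zd by (simp add: mult.assoc)
        next
          case False
          have "- artanh r * bloch_radius_rate L \<rho> =
              artanh r / r * (G * (r\<^sup>2 - z\<^sup>2) - z * (g * (z_inf - z)))"
            unfolding rd using False by (simp add: field_simps)
          then show ?thesis
            using interior_production_nonneg[OF w, of r z g G] rhs r True False zd by simp
        qed
        then show ?thesis
          using entropy_production_rate_interior[OF \<rho> _ w] True by (simp add: r_def L_def)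
      next
        case False
        then have r1: "r = 1" using r by simp
        have z1: "z\<^sup>2 \<le> 1" using r r1 by simp
        \<comment> \<open>This rules out the value -infinity; only a vanishing radius rate then
          needs an argument.\<close>
        have le: "0 \<le> - bloch_radius_rate L \<rho>"
          using boundary_inward_rate_nonneg[OF w z1, of g G] rhs unfolding rd by (simp add: r1)
        \<comment> \<open>The threshold for \<open>G\<close> is nonnegative since sqrt (1 - w^2) <=
          1.\<close>
        have "0 \<le> g * (1 - sqrt (1 - z_inf\<^sup>2))" using rhs by simp
        then have G0: "0 \<le> G" using conjunct2[OF rhs] by linarith
        have "0 \<le> bloch_z (L \<rho>) * artanh z_inf" if "bloch_radius_rate L \<rho> = 0"
          using boundary_production_nonneg[OF w z1, of g G] rhs G0 that unfolding rd zd
          by (simp add: r1)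
        then show ?thesis
          using False le by (auto simp: entropy_production_rate_def r_def[symmetric])
      qed
    qed
  qed
  then show ?thesis
    unfolding P L_def[symmetric] map_entropy_production_def le_INF_iff .
qed

end
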